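(* Let $N\ge1$, $n\ge 0$ and let $\boldsymbol h=(h^{(1)},\dots,h^{(N)})$ be integers with $1\le h^{(k)}\le k$. The map $\boldsymbol w=w_1\cdots w_n\mapsto(\mathscr P^{\boldsymbol h}_{\boldsymbol w},\mathscr Q^{\boldsymbol h}_{\boldsymbol w})$ defined by successive $\boldsymbol h$-insertion and recording is a bijection between the set of words of length $n$ in the alphabet $\{1,\dots,N\}$ and the set of pairs $(\mathscr P,\mathscr Q)$ of Young tableaux of the same shape with $n$ boxes, where $\mathscr P$ is a semistandard tableau over the alphabet $\{1,\dots,N\}$ and $\mathscr Q$ is a standard tableau.
   Context: **Tableaux and arrays.** A semistandard Young tableau over $\{1,\dots,N\}$ has entries weakly increasing along rows and strictly increasing down columns; a standard tableau with $n$ boxes uses each of $1,\dots,n$ once, strictly increasing along rows and columns. Semistandard tableaux over $\{1,\dots,N\}$ are identified with interlacing arrays $\boldsymbol\lambda=(\lambda^{(1)}\prec\dots\prec\lambda^{(N)})$ of nonnegative integers, $\lambda^{(k)}=(\lambda^{(k)}_1\ge\dots\ge\lambda^{(k)}_k\ge0)$, $\lambda^{(k)}_{j+1}\le\lambda^{(k-1)}_j\le\lambda^{(k)}_j$: $\lambda^{(k)}$ is the shape formed by the boxes containing letters $\le k$. The numbers $\lambda^{(k)}_j$ are called particles; "$\lambda^{(k)}_j$ moves" means it increases by $1$. **$\boldsymbol h$-insertion** $\mathcal I^{\boldsymbol h}_m$ of a letter $m\in\{1,\dots,N\}$ into $\boldsymbol\lambda$. Levels $1,\dots,m-1$ do not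 change, and exactly one particle moves at each level $m,m+1,\dots,N$, chosen as follows (all comparisons use the values before the insertion). - (donation) When a particle $\lambda^{(k)}_j$ is asked to move but is blocked, i.e. $j\ge2$ and $\lambda^{(k)}_j=\lambda^{(k-1)}_{j-1}$, then instead the particle $\lambda^{(k)}_i$ moves, where $i<j$ is the largest index such that $\lambda^{(k)}_i$ is not blocked ($\lambda^{(k)}_1$ is never blocked). - (start) At level $m$ the particle $\lambda^{(m)}_{h^{(m)}}$ is asked to move (with donation if blocked). - (step) Suppose that $\lambda^{(k-1)}_j$ has moved at level $k-1$, $m+1\le k\le N$. If $\lambda^{(k)}_j=\lambda^{(k-1)}_j$ or $j<h^{(k)}$, then $\lambda^{(k)}_j$ is asked to move (with donation if blocked). Otherwise $\lambda^{(k)}_{j+1}$ moves. The result is a semistandard tableau whose shape has exactly one more box. **Correspondence.** $\mathscr P^{\boldsymbol h}_{\boldsymbol w}=\mathcal I^{\boldsymbol h}_{w_n}\cdots\mathcal I^{\boldsymbol h}_{w_1}\varnothing$, starting from the empty tableau (the zero array). $\mathscr Q^{\boldsymbol h}_{\boldsymbol w}$ is the standard tableau of the same shape in which the box added to the shape at the $i$th insertion (of $w_i$) contains $i$. *)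

theory Defs
  imports Main
begin

text \<open>
  A box is a pair (row, column), both counted from 1. A tableau is a partial map from boxes to
  entries; its shape is its domain.
\<close>

type_synonym tableau = "nat \<times> nat \<rightharpoonup> nat"

definition young_diagram :: "(nat \<times> nat) set \<Rightarrow> bool" where
  "young_diagram D \<longleftrightarrow> finite D \<and>
     (\<forall>(i, c) \<in> D. 1 \<le> i \<and> 1 \<le> c \<and> {1..i} \<times> {1..c} \<subseteq> D)"

definition semistandard :: "nat \<Rightarrow> tableau \<Rightarrow> bool" where
  "semistandard N T \<longleftrightarrow> young_diagram (dom T) \<and> ran T \<subseteq> {1..N} \<and>
     (\<forall>i c d a b. c < d \<longrightarrow> T (i, c) = Some a \<longrightarrow> T (i, d) = Some b \<longrightarrow> a \<le> b) \<and>
     (\<forall>i j c a b. i < j \<longrightarrow> T (i, c) = Some a \<longrightarrow> T (j, c) = Some b \<longrightarrow> a < b)"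

definition standard :: "tableau \<Rightarrow> bool" where
  "standard T \<longleftrightarrow> young_diagram (dom T) \<and>
     ran T = {1..card (dom T)} \<and> inj_on T (dom T) \<and>
     (\<forall>i c d a b. c < d \<longrightarrow> T (i, c) = Some a \<longrightarrow> T (i, d) = Some b \<longrightarrow> a < b) \<and>
     (\<forall>i j c a b. i < j \<longrightarrow> T (i, c) = Some a \<longrightarrow> T (j, c) = Some b \<longrightarrow> a < b)"

text \<open>
  An array is a function \<open>\<lambda>\<close> of a level \<open>k\<close> and an index \<open>j\<close>; only the values with
  \<open>1 \<le> j \<le> k \<le> N\<close> are particles, all others are 0. In particular
  level 0 is the empty partition.
\<close>

type_synonym array = "nat \<Rightarrow> nat \<Rightarrow> nat"

definition interlacing :: "nat \<Rightarrow> array \<Rightarrow> bool" where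
  "interlacing N L \<longleftrightarrow>
     (\<forall>k \<in> {2..N}. \<forall>j \<in> {1..<k}. L k (j + 1) \<le> L (k - 1) j \<and> L (k - 1) j \<le> L k j) \<and>
     (\<forall>k j. \<not> (1 \<le> j \<and> j \<le> k \<and> k \<le> N) \<longrightarrow> L k j = 0)"

text \<open>
  The identification of arrays with tableaux: level \<open>k\<close> is the shape formed by the boxes with
  letters \<open>\<le> k\<close>, so a box carries the first level whose shape contains it.
\<close>

definition tableau_of_array :: "nat \<Rightarrow> array \<Rightarrow> tableau" where
  "tableau_of_array N L = (\<lambda>(i, c).
     if 1 \<le> i \<and> 1 \<le> c \<and> c \<le> L N i then Some (LEAST k. c \<le> L k i) else None)"

lemma interlacing_mono:
  assumes "interlacing N L" "k \<le> k'" "k' \<le> N"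
  shows "L k i \<le> L k' i"
  using assms(2,3)
proof (induction k' rule: dec_induct)
  case (step l)
  have "L l i \<le> L (Suc l) i"
  proof (cases "1 \<le> i \<and> i \<le> l")
    case True
    then have "Suc l \<in> {2..N}" "i \<in> {1..<Suc l}"
      using step by auto
    then have "L (Suc l - 1) i \<le> L (Suc l) i"
      using assms(1) unfolding interlacing_def by blast
    then show ?thesis by simp
  next
    case False
    then have "L l i = 0" using assms(1) unfolding interlacing_def by blast
    then show ?thesis by simp
  qed
  with step show ?case by simp
qed simp

lemma tableau_of_array_level:
  assumes "interlacing N L" "k \<le> N"
  shows "{(i, c). \<exists>a. tableau_of_array N L (i, c) = Some a \<and> a \<le> k}
       = {(i, c). 1 \<le> i \<and> 1 \<le> c \<and> c \<le> L k i}"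
proof -
  have *: "c \<le> L N i \<and> (LEAST k. c \<le> L k i) \<le> k \<longleftrightarrow> c \<le> L k i" for i c
  proof (intro iffI conjI; (elim conjE)?)
    assume a: "c \<le> L N i" and l: "(LEAST k. c \<le> L k i) \<le> k"
    have "c \<le> L (LEAST k. c \<le> L k i) i"
      by (rule LeastI[where P = "\<lambda>k. c \<le> L k i", OF a])
    also have "\<dots> \<le> L k i" by (rule interlacing_mono[OF assms(1) l assms(2)])
    finally show "c \<le> L k i" .
  next
    assume a: "c \<le> L k i"
    then show "c \<le> L N i"
      using interlacing_mono[OF assms(1,2) order_refl, of i] by (rule order_trans)
    from a show "(LEAST k. c \<le> L k i) \<le> k" by (rule Least_le)
  qed
  have "(\<exists>a. tableau_of_array N L (i, c) = Some a \<and> a \<le> k) \<longleftrightarrow>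
      1 \<le> i \<and> 1 \<le> c \<and> (c \<le> L N i \<and> (LEAST k. c \<le> L k i) \<le> k)" for i c
    unfolding tableau_of_array_def prod.case by (cases "1 \<le> i \<and> 1 \<le> c \<and> c \<le> L N i") auto
  then show ?thesis unfolding * by simp
qed

definition blocked :: "array \<Rightarrow> nat \<Rightarrow> nat \<Rightarrow> bool" where
  "blocked L k j \<longleftrightarrow> 2 \<le> j \<and> L k j = L (k - 1) (j - 1)"

text \<open>The index of the particle that moves at level \<open>k\<close> when particle \<open>j\<close> is asked to.\<close>

definition donate :: "array \<Rightarrow> nat \<Rightarrow> nat \<Rightarrow> nat" where
  "donate L k j = (if blocked L k j then Max {i \<in> {1..<j}. \<not> blocked L k i} else j)"

text \<open>
  The index of the particle that moves at level \<open>k\<close> when the letter \<open>m\<close> is inserted; the value is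
  irrelevant for \<open>k < m\<close>, where nothing moves.
\<close>

fun moved :: "(nat \<Rightarrow> nat) \<Rightarrow> array \<Rightarrow> nat \<Rightarrow> nat \<Rightarrow> nat" where
  "moved h L m 0 = 0"
| "moved h L m (Suc k) =
     (if Suc k < m then 0
      else if Suc k = m then donate L m (h m)
      else let j = moved h L m k in
        if L (Suc k) j = L k j \<or> j < h (Suc k) then donate L (Suc k) j else j + 1)"

definition h_insert :: "nat \<Rightarrow> (nat \<Rightarrow> nat) \<Rightarrow> nat \<Rightarrow> array \<Rightarrow> array" where
  "h_insert N h m L = (\<lambda>k j.
     if m \<le> k \<and> k \<le> N \<and> j = moved h L m k then L k j + 1 else L k j)"

definition P_tableau :: "nat \<Rightarrow> (nat \<Rightarrow> nat) \<Rightarrow> nat list \<Rightarrow> tableau" where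
  "P_tableau N h w = tableau_of_array N (fold (h_insert N h) w (\<lambda>_ _. 0))"

definition added_at :: "nat \<Rightarrow> (nat \<Rightarrow> nat) \<Rightarrow> nat list \<Rightarrow> nat \<Rightarrow> (nat \<times> nat) set" where
  "added_at N h w t = dom (P_tableau N h (take t w)) - dom (P_tableau N h (take (t - 1) w))"

definition Q_tableau :: "nat \<Rightarrow> (nat \<Rightarrow> nat) \<Rightarrow> nat list \<Rightarrow> tableau" where
  "Q_tableau N h w = (\<lambda>b.
     if b \<in> dom (P_tableau N h w)
     then Some (THE t. t \<in> {1..length w} \<and> b \<in> added_at N h w t) else None)"

end

theory Submission
  imports Defs
begin

text \<open>
  The insertion is inverted level by level. Write \<open>mu\<close>, \<open>lam\<close> for two consecutive levels before the
  insertion and \<open>mu'\<close>, \<open>lam'\<close> for the levels after it. For fixed \<open>lam\<close> and \<open>mu'\<close>, the indices \<open>j\<close> that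
  may have moved at the lower level (\<open>j = 0\<close> if the insertion starts at the upper one) are in
  bijection with the indices \<open>r\<close> that may move at the upper level. Hence \<open>mu'\<close>, \<open>lam'\<close> and \<open>r\<close>
  determine \<open>j\<close>, and descending through the levels recovers the letter and the old array from the new
  array and the row of the new box. That row is read off from the position of the largest entry of
  the recording tableau, so the word is recovered letter by letter.
\<close>

section \<open>The local rule between two consecutive levels and its inversion\<close>

definition interlaces :: "nat \<Rightarrow> (nat \<Rightarrow> nat) \<Rightarrow> (nat \<Rightarrow> nat) \<Rightarrow> bool" where
  "interlaces k mu lam \<longleftrightarrow> (\<forall>j\<in>{1..k}. lam (Suc j) \<le> mu j \<and> mu j \<le> lam j)"

definition blk :: "(nat \<Rightarrow> nat) \<Rightarrow> (nat \<Rightarrow> nat) \<Rightarrow> nat \<Rightarrow> bool" where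
  "blk mu lam i \<longleftrightarrow> 2 \<le> i \<and> lam i = mu (i - 1)"

text \<open>An unblocked \<open>j\<close> is itself the maximum of this set, so one formula covers
  both branches of \<open>donate\<close>.\<close>

definition don :: "(nat \<Rightarrow> nat) \<Rightarrow> (nat \<Rightarrow> nat) \<Rightarrow> nat \<Rightarrow> nat" where
  "don mu lam j = Max {i\<in>{1..j}. \<not> blk mu lam i}"

text \<open>Index \<open>j = 0\<close> stands for no move at the lower level: the insertion then
  starts at the upper one, at its prescribed index \<open>H\<close>.\<close>

definition next_moved :: "nat \<Rightarrow> (nat \<Rightarrow> nat) \<Rightarrow> (nat \<Rightarrow> nat) \<Rightarrow> nat \<Rightarrow> nat" where
  "next_moved H mu lam j =
     (if j = 0 then don mu lam H else if lam j = mu j \<or> j < H then don mu lam j else Suc j)"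

text \<open>Index 0 is the code for no move, hence the identity there.\<close>

definition inc :: "nat \<Rightarrow> (nat \<Rightarrow> nat) \<Rightarrow> nat \<Rightarrow> nat" where
  "inc j f = (if j = 0 then f else f(j := Suc (f j)))"

text \<open>Index 0 gets no case of its own: the arrays vanish there, and truncated subtraction
  leaves that 0 unchanged.\<close>

definition dec :: "nat \<Rightarrow> (nat \<Rightarrow> nat) \<Rightarrow> nat \<Rightarrow> nat" where
  "dec j f = f(j := f j - 1)"

lemma dec_inc: "f 0 = 0 \<Longrightarrow> dec j (inc j f) = f"
  by (auto simp: dec_def inc_def fun_eq_iff)

lemma inc_dec: "j = 0 \<or> 0 < f j \<Longrightarrow> f 0 = 0 \<Longrightarrow> inc j (dec j f) = f"
  by (auto simp: dec_def inc_def fun_eq_iff)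

lemma don_props:
  assumes "1 \<le> j"
  shows "1 \<le> don mu lam j" "don mu lam j \<le> j" "\<not> blk mu lam (don mu lam j)"
    "\<And>i. don mu lam j < i \<Longrightarrow> i \<le> j \<Longrightarrow> blk mu lam i"
proof -
  let ?S = "{i\<in>{1..j}. \<not> blk mu lam i}"
  have fin: "finite ?S" by simp
  have "1 \<in> ?S" using assms by (auto simp: blk_def)
  then have "don mu lam j \<in> ?S"
    unfolding don_def by (intro Max_in fin) blast
  then show "1 \<le> don mu lam j" "don mu lam j \<le> j" "\<not> blk mu lam (don mu lam j)" by auto
  fix i assume i: "don mu lam j < i" "i \<le> j"
  show "blk mu lam i"
  proof (rule ccontr)
    assume "\<not> blk mu lam i"
    with i have "i \<in> ?S" by auto
    then have "i \<le> don mu lam j" unfolding don_def by (rule Max_ge[OF fin])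
    with i show False by simp
  qed
qed

lemma don_eq_iff:
  assumes "1 \<le> j"
  shows "don mu lam j = r \<longleftrightarrow>
    1 \<le> r \<and> r \<le> j \<and> \<not> blk mu lam r \<and> (\<forall>i. r < i \<longrightarrow> i \<le> j \<longrightarrow> blk mu lam i)"
  using don_props[OF assms, of mu lam] by (meson linorder_neqE_nat)

text \<open>A blocked \<open>j\<close> is excluded from the maximum anyway, so the ranges
  \<open>{1..<j}\<close> and \<open>{1..j}\<close> give the same set; an unblocked \<open>j\<close>
  is its own donor.\<close>

lemma donate_eq_don:
  assumes "1 \<le> j"
  shows "donate L (Suc k) j = don (L k) (L (Suc k)) j"
proof -
  have b: "blocked L (Suc k) i = blk (L k) (L (Suc k)) i" for i
    by (auto simp: blocked_def blk_def)
  show ?thesis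
  proof (cases "blk (L k) (L (Suc k)) j")
    case True
    then have "{i\<in>{1..<j}. \<not> blk (L k) (L (Suc k)) i} = {i\<in>{1..j}. \<not> blk (L k) (L (Suc k)) i}"
      by (auto simp: order_le_less)
    then show ?thesis using True by (simp add: donate_def don_def b)
  next
    case False
    then have "don (L k) (L (Suc k)) j = j" using assms by (subst don_eq_iff) auto
    then show ?thesis using False by (simp add: donate_def b)
  qed
qed

text \<open>Two facts carry the proof: for \<open>r\<close> at least 2 the chosen particle has room
  below its lower neighbour after the move, \<open>lam r < inc j mu (r - 1)\<close>, and a lower
  particle pushes an equal upper one along (\<open>lam j = mu j\<close> forces
  \<open>r = j\<close>). The assumption \<open>dec\<close> says that row \<open>j\<close> of the
  lower shape could grow; the last conclusion hands the same fact to the next level.\<close>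

lemma next_moved_forward:
  assumes il: "interlaces k mu lam" and H: "1 \<le> H" "H \<le> Suc k" and j: "j \<le> k"
    and dec: "2 \<le> j \<Longrightarrow> mu j < mu (j - 1)"
  defines "r \<equiv> next_moved H mu lam j"
  shows "1 \<le> r" "r \<le> Suc k" "interlaces k (inc j mu) (inc r lam)"
    "2 \<le> r \<Longrightarrow> lam r < lam (r - 1)"
proof -
  have il1: "lam (Suc i) \<le> mu i" "mu i \<le> lam i" if "1 \<le> i" "i \<le> k" for i
    using il that by (auto simp: interlaces_def)
  have r: "1 \<le> r \<and> r \<le> Suc k \<and> (2 \<le> r \<longrightarrow> lam r < inc j mu (r - 1)) \<and>
      (j \<noteq> 0 \<longrightarrow> lam j = mu j \<longrightarrow> r = j)"
  proof -
    have nb: "lam i < inc j mu (i - 1)" if "\<not> blk mu lam i" "2 \<le> i" "i \<le> Suc k" for i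
      using that il1[of "i - 1"] by (cases i) (auto simp: blk_def inc_def)
    consider "j = 0" | "j \<noteq> 0" "lam j = mu j" | "j \<noteq> 0" "lam j \<noteq> mu j" "j < H"
      | "j \<noteq> 0" "lam j \<noteq> mu j" "\<not> j < H" by blast
    then show ?thesis
    proof cases
      case 1
      then have "r = don mu lam H" by (simp add: r_def next_moved_def)
      then show ?thesis using don_props[OF H(1), of mu lam] H nb 1 by auto
    next
      case 2
      \<comment> \<open>For \<open>j\<close> at least 2, \<open>lam j = mu j < mu (j - 1)\<close>,
        so a pushed particle never donates.\<close>
      then have "\<not> blk mu lam j" using dec by (auto simp: blk_def)
      then have "don mu lam j = j" using 2 by (subst don_eq_iff) auto
      then have "r = j" using 2 by (simp add: r_def next_moved_def)
      moreover have "2 \<le> j \<Longrightarrow> lam j < inc j mu (j - 1)"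
        using nb[of j] \<open>\<not> blk mu lam j\<close> j by simp
      ultimately show ?thesis using 2 j by auto
    next
      case 3
      then have "r = don mu lam j" by (simp add: r_def next_moved_def)
      then show ?thesis using don_props[of j mu lam] 3 j nb by auto
    next
      case 4
      then have "r = Suc j" by (simp add: r_def next_moved_def)
      \<comment> \<open>The lower move itself makes the room: \<open>lam (Suc j)\<close> is at most
        \<open>mu j\<close>, which has grown by 1.\<close>
      then show ?thesis using 4 j il1[of j] by (auto simp: inc_def)
    qed
  qed
  then show "1 \<le> r" "r \<le> Suc k" by auto
  have lt: "2 \<le> r \<Longrightarrow> lam r < inc j mu (r - 1)" and push: "j \<noteq> 0 \<Longrightarrow> lam j = mu j \<Longrightarrow> r = j"
    using r by auto
  show "interlaces k (inc j mu) (inc r lam)"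
    unfolding interlaces_def
  proof
    fix i assume "i \<in> {1..k}"
    then have i: "lam (Suc i) \<le> mu i" "mu i \<le> lam i" "1 \<le> i" using il1 by auto
    have "inc r lam (Suc i) \<le> inc j mu i"
    proof (cases "r = Suc i")
      case True
      then have "lam (Suc i) < inc j mu i" using lt i(3) by simp
      then show ?thesis using True by (simp add: inc_def)
    next
      case False
      then have "inc r lam (Suc i) = lam (Suc i)" by (simp add: inc_def)
      moreover have "mu i \<le> inc j mu i" by (simp add: inc_def)
      ultimately show ?thesis using i(1) by simp
    qed
    moreover have "inc j mu i \<le> inc r lam i"
    proof (cases "j = i \<and> lam i = mu i")
      case True
      then have "r = i" using push i(3) by simp
      then show ?thesis using True i(3) by (simp add: inc_def)
    next
      case False
      then have "inc j mu i \<le> lam i" using i(2,3) by (cases "j = i") (auto simp: inc_def)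
      also have "\<dots> \<le> inc r lam i" by (simp add: inc_def)
      finally show ?thesis .
    qed
    ultimately show "inc r lam (Suc i) \<le> inc j mu i \<and> inc j mu i \<le> inc r lam i" by simp
  qed
  assume r2: "2 \<le> r"
  show "lam r < lam (r - 1)"
  \<comment> \<open>For \<open>j = r - 1\<close> the fact \<open>lt\<close> yields only that
    \<open>lam r\<close> is at most \<open>mu j\<close>; strictness comes from
    \<open>mu j < lam j\<close>, as equality would have forced \<open>r = j\<close>.\<close>
  proof (cases "j = r - 1")
    case True
    then have "lam j \<noteq> mu j" "1 \<le> j" using push r2 by auto
    then show ?thesis using il1[of j] j True r2 by simp
  next
    case False
    then have "inc j mu (r - 1) = mu (r - 1)" by (simp add: inc_def)
    then have "lam r < mu (r - 1)" using lt r2 by simp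
    also have "\<dots> \<le> lam (r - 1)" using \<open>r \<le> Suc k\<close> r2 by (intro il1) auto
    finally show ?thesis .
  qed
qed

lemma ex1_nat_by_less:
  fixes R :: "nat \<Rightarrow> bool"
  assumes "\<exists>j. R j" "\<And>i j. i < j \<Longrightarrow> \<not> (R i \<and> R j)"
  shows "\<exists>!j. R j"
  using assms by (metis linorder_neqE_nat)

text \<open>The old upper level has to be \<open>dec r lam'\<close>; the question is whether it
  interlaces with the new lower level \<open>mu'\<close>. If it does not, only a push can have
  happened. If it does, the possible \<open>j\<close> are matched with the possible \<open>r\<close>
  by a permutation. The assumption on \<open>lam'\<close> says that row \<open>r\<close> ends in a
  removable box.\<close>

lemma next_moved_backward:
  assumes il: "interlaces k mu' lam'" and H: "1 \<le> H" "H \<le> Suc k"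
    and r: "1 \<le> r" "r \<le> Suc k" "lam' (Suc r) < lam' r" and mu0: "mu' 0 = 0"
  shows "\<exists>!j. j \<le> k \<and> (j = 0 \<or> 0 < mu' j) \<and> interlaces k (dec j mu') (dec r lam') \<and>
    next_moved H (dec j mu') (dec r lam') j = r"
    (is "\<exists>!j. ?P j")
proof -
  define lam where "lam = dec r lam'"
  have il1: "lam' (Suc i) \<le> mu' i" "mu' i \<le> lam' i" if "1 \<le> i" "i \<le> k" for i
    using il that by (auto simp: interlaces_def)
  have lr: "lam' r = Suc (lam r)" and lo: "\<And>i. i \<noteq> r \<Longrightarrow> lam i = lam' i"
    using r by (auto simp: lam_def dec_def)
  show ?thesis
  proof (cases "interlaces k mu' lam")
    case False
    txt \<open>Then \<open>mu' r = lam r + 1\<close>: the lower particle \<open>r\<close> has pushed the upper one.\<close>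
    have le: "lam (Suc i) \<le> mu' i" if "1 \<le> i" "i \<le> k" for i
      using il1[OF that] lr lo[of "Suc i"] by (cases "Suc i = r") auto
    obtain i where i: "1 \<le> i" "i \<le> k" "lam i < mu' i"
      using False le by (fastforce simp: interlaces_def not_le)
    \<comment> \<open>Only the entry \<open>r\<close> was lowered, so the inequality can fail
      nowhere else.\<close>
    have ir: "i = r" using i il1[of i] lo[of i] by fastforce
    have mr: "mu' r = Suc (lam r)" using i ir il1[of r] lr by auto
    show ?thesis
    proof (rule ex1I[of _ r])
      have "interlaces k (dec r mu') lam"
        unfolding interlaces_def
      proof
        fix x assume "x \<in> {1..k}"
        then show "lam (Suc x) \<le> dec r mu' x \<and> dec r mu' x \<le> lam x"
          using le[of x] il1[of x] mr lr lo[of x] lo[of "Suc r"] r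
          by (cases "x = r") (auto simp: dec_def)
      qed
      \<comment> \<open>If \<open>r\<close> is at least 2, then \<open>lam r < lam' r\<close>, which
        is at most \<open>mu' (r - 1)\<close>.\<close>
      moreover have "\<not> blk (dec r mu') lam r"
        using lr r il1[of "r - 1"] by (cases r) (auto simp: blk_def dec_def)
      then have "don (dec r mu') lam r = r" using r by (subst don_eq_iff) auto
      then have "next_moved H (dec r mu') lam r = r"
        using r mr by (simp add: next_moved_def dec_def)
      ultimately show "?P r" using i ir mr by (auto simp: lam_def)
    next
      fix j assume "?P j"
      \<comment> \<open>Interlacing at index \<open>r\<close> requires \<open>mu' r\<close> to be
        lowered, which only \<open>dec r\<close> does.\<close>
      then have "dec j mu' r \<le> lam r" using i ir by (auto simp: interlaces_def lam_def)
      then show "j = r" using mr by (auto simp: dec_def split: if_splits)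
    qed
  next
    case True
    txt \<open>Both the admissible \<open>j\<close> (as \<open>j + 1\<close>) and the possible values of \<open>r\<close> range over the
      indices unblocked with respect to \<open>mu'\<close>, and \<open>next_moved\<close> permutes these: it shifts the ones
      \<open>\<le> H\<close> cyclically and fixes the others.\<close>
    have il2: "lam (Suc i) \<le> mu' i" "mu' i \<le> lam i" if "1 \<le> i" "i \<le> k" for i
      using True that by (auto simp: interlaces_def)
    have nbr: "\<not> blk mu' lam r"
      using lr r il1[of "r - 1"] by (cases r) (auto simp: blk_def)
    \<comment> \<open>Lowering \<open>mu' j\<close> keeps its upper bound \<open>lam j\<close>, so
      the only obstruction is \<open>lam (Suc j) = mu' j\<close>, that is, a blocked
      \<open>Suc j\<close>.\<close>
    have adm: "(j \<le> k \<and> (j = 0 \<or> 0 < mu' j) \<and> interlaces k (dec j mu') lam) \<longleftrightarrow>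
        j \<le> k \<and> (j = 0 \<or> \<not> blk mu' lam (Suc j))" (is "?l \<longleftrightarrow> ?r") for j
    proof
      assume l: ?l
      show ?r
      proof (cases "j = 0")
        case False
        then have "lam (Suc j) \<le> dec j mu' j" "0 < mu' j"
          using l by (auto simp: interlaces_def)
        then have "lam (Suc j) < mu' j" by (auto simp: dec_def)
        then show ?thesis using l by (auto simp: blk_def)
      qed (use l in simp)
    next
      assume r: ?r
      show ?l
      proof (cases "j = 0")
        case True
        then have "dec j mu' = mu'" using mu0 by (auto simp: dec_def)
        then show ?thesis using \<open>interlaces k mu' lam\<close> True by simp
      next
        case False
        then have lt: "lam (Suc j) < mu' j" using r il2[of j] by (auto simp: blk_def)
        have "interlaces k (dec j mu') lam"
          unfolding interlaces_def
        proof
          fix x assume "x \<in> {1..k}"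
          then show "lam (Suc x) \<le> dec j mu' x \<and> dec j mu' x \<le> lam x"
            using il2[of x] lt by (cases "x = j") (auto simp: dec_def)
        qed
        then show ?thesis using r lt by auto
      qed
    qed
    \<comment> \<open>Donation from \<open>j\<close> looks at \<open>mu\<close> only below index
      \<open>j\<close>, so \<open>dec j mu'\<close> may be replaced by \<open>mu'\<close>. A push is
      impossible, because \<open>mu' j - 1 < lam j\<close>.\<close>
    have nm: "next_moved H (dec j mu') lam j =
        (if j = 0 then don mu' lam H else if j < H then don mu' lam j else Suc j)"
      if j: "j \<le> k" "j = 0 \<or> \<not> blk mu' lam (Suc j)" for j
    proof (cases "j = 0")
      case True
      then have "dec j mu' = mu'" using mu0 by (auto simp: dec_def)
      then show ?thesis using True by (simp add: next_moved_def)
    next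
      case False
      then have "lam (Suc j) < mu' j" using j il2[of j] by (auto simp: blk_def)
      then have "lam j \<noteq> dec j mu' j" using False il2[of j] j by (auto simp: dec_def)
      moreover have "blk (dec j mu') lam i = blk mu' lam i" if "i \<le> j" for i
        using that by (auto simp: blk_def dec_def)
      then have "{i\<in>{1..j}. \<not> blk (dec j mu') lam i} = {i\<in>{1..j}. \<not> blk mu' lam i}" by auto
      then have "don (dec j mu') lam j = don mu' lam j" by (simp add: don_def)
      ultimately show ?thesis using False by (simp add: next_moved_def)
    qed
    let ?Q = "\<lambda>j. j \<le> k \<and> (j = 0 \<or> \<not> blk mu' lam (Suc j)) \<and>
      (if j = 0 then don mu' lam H else if j < H then don mu' lam j else Suc j) = r"
    have PQ: "?P j \<longleftrightarrow> ?Q j" for j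
      using adm[of j] nm[of j] unfolding lam_def[symmetric] by metis
    have ex: "\<exists>j. ?Q j"
    proof (cases "H < r")
      case True
      then have "?Q (r - 1)" using H r nbr by auto
      then show ?thesis by blast
    next
      case False
      \<comment> \<open>When \<open>r\<close> is at most \<open>H\<close>, the preimage is one less
        than the next unblocked index up to \<open>H\<close>; if there is none, donation from
        \<open>H\<close> ends at \<open>r\<close> and the preimage is 0.\<close>
      define S where "S = {j\<in>{r..<H}. \<not> blk mu' lam (Suc j)}"
      show ?thesis
      proof (cases "S = {}")
        case True
        have "blk mu' lam i" if "r < i" "i \<le> H" for i
          using that True unfolding S_def by (cases i) auto
        then have "?Q 0" using False H r nbr by (simp add: don_eq_iff)
        then show ?thesis by blast
      next
        case nonempty: False
        define j where "j = Min S"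
        have fin: "finite S" by (simp add: S_def)
        have j: "j \<in> S" unfolding j_def by (rule Min_in[OF fin nonempty])
        have "blk mu' lam i" if i: "r < i" "i \<le> j" for i
        proof (rule ccontr)
          assume "\<not> blk mu' lam i"
          then have "i - 1 \<in> S" using i j by (auto simp: S_def)
          then have "j \<le> i - 1" unfolding j_def by (rule Min_le[OF fin])
          with i show False by simp
        qed
        then have "don mu' lam j = r" using j r nbr by (subst don_eq_iff) (auto simp: S_def)
        then have "?Q j" using j H r by (auto simp: S_def)
        then show ?thesis by blast
      qed
    qed
    \<comment> \<open>If \<open>j < H\<close>, the unblocked index \<open>Suc i\<close> (or
      \<open>Suc j\<close> when \<open>i = 0\<close>) lies above \<open>r\<close> in the range that
      donation from \<open>j\<close> (or from \<open>H\<close>) to \<open>r\<close> requires to be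
      blocked. Otherwise \<open>r = Suc j\<close>, while \<open>i\<close> leads to a smaller
      index.\<close>
    have disj: "\<not> (?Q i \<and> ?Q j)" if "i < j" for i j
    proof
      assume Q: "?Q i \<and> ?Q j"
      then have nb: "\<not> blk mu' lam (Suc j)" and nbi: "i = 0 \<or> \<not> blk mu' lam (Suc i)"
        using that by auto
      have dH: "don mu' lam H \<le> H" using don_props[OF H(1)] by auto
      show False
      proof (cases "j < H")
        case True
        then have dj: "don mu' lam j = r" using Q that by auto
        then have rj: "r \<le> j" "\<And>x. r < x \<Longrightarrow> x \<le> j \<Longrightarrow> blk mu' lam x"
          using that don_eq_iff[of j mu' lam r] by auto
        show False
        proof (cases "i = 0")
          case True
          then have "don mu' lam H = r" using Q by simp
          then have "blk mu' lam (Suc j)"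
            using rj(1) \<open>j < H\<close> don_eq_iff[OF H(1), of mu' lam r] by auto
          then show False using nb by simp
        next
          case False
          then have "don mu' lam i = r" using Q True that by auto
          then have "r \<le> i" using False don_eq_iff[of i mu' lam r] by auto
          then show False using rj(2)[of "Suc i"] that False nbi by auto
        qed
      next
        case False
        then have "r = Suc j" using Q that by auto
        then show False using Q False that dH don_props(2)[of i mu' lam]
          by (auto split: if_splits)
      qed
    qed
    have "\<exists>!j. ?Q j"
      by (rule ex1_nat_by_less[of ?Q, OF ex]) (rule disj)
    then show ?thesis unfolding PQ .
  qed
qed

section \<open>Insertion into arrays and its inversion, by induction on the number of levels\<close>

text \<open>As \<open>interlacing N\<close> demands zeros above level \<open>N\<close>, the top
  level has to be cleared before the induction hypothesis can apply.\<close>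

abbreviation truncate_array :: "nat \<Rightarrow> array \<Rightarrow> array" where
  "truncate_array N L \<equiv> L(Suc N := (\<lambda>_. 0))"

lemma interlacing_Suc:
  "interlacing (Suc N) L \<longleftrightarrow> interlacing N (truncate_array N L) \<and>
     interlaces N (L N) (L (Suc N)) \<and> (\<forall>j. \<not> (1 \<le> j \<and> j \<le> Suc N) \<longrightarrow> L (Suc N) j = 0)"
  (is "?l \<longleftrightarrow> ?r")
proof
  assume l: ?l
  have "interlaces N (L N) (L (Suc N))"
    unfolding interlaces_def
  proof
    fix j assume j: "j \<in> {1..N}"
    then have "Suc N \<in> {2..Suc N}" "j \<in> {1..<Suc N}" by auto
    then have "L (Suc N) (j + 1) \<le> L (Suc N - 1) j \<and> L (Suc N - 1) j \<le> L (Suc N) j"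
      using l unfolding interlacing_def by blast
    then show "L (Suc N) (Suc j) \<le> L N j \<and> L N j \<le> L (Suc N) j" by simp
  qed
  moreover have "interlacing N (truncate_array N L)"
    using l unfolding interlacing_def by auto
  ultimately show ?r using l unfolding interlacing_def by auto
next
  assume r: ?r
  show ?l
    unfolding interlacing_def
  proof (intro conjI ballI allI impI)
    fix k j assume "k \<in> {2..Suc N}" "j \<in> {1..<k}"
    then have "L k (j + 1) \<le> L (k - 1) j \<and> L (k - 1) j \<le> L k j"
    proof (cases "k = Suc N")
      case True
      then show ?thesis using r \<open>j \<in> {1..<k}\<close> by (auto simp: interlaces_def)
    next
      case False
      then have "k \<in> {2..N}" using \<open>k \<in> _\<close> by auto
      then have "truncate_array N L k (j + 1) \<le> truncate_array N L (k - 1) j \<and>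
          truncate_array N L (k - 1) j \<le> truncate_array N L k j"
        using r \<open>j \<in> {1..<k}\<close> unfolding interlacing_def by blast
      moreover have "k - 1 \<noteq> Suc N" using \<open>k \<in> {2..N}\<close> by auto
      ultimately show ?thesis using False by simp
    qed
    then show "L k (j + 1) \<le> L (k - 1) j" "L (k - 1) j \<le> L k j" by auto
  next
    fix k j assume kj: "\<not> (1 \<le> j \<and> j \<le> k \<and> k \<le> Suc N)"
    show "L k j = 0"
    proof (cases "k = Suc N")
      case False
      then have "\<not> (1 \<le> j \<and> j \<le> k \<and> k \<le> N)" using kj by auto
      then have "truncate_array N L k j = 0" using r unfolding interlacing_def by blast
      then show ?thesis using False by simp
    qed (use r kj in auto)
  qed
qed

lemma interlacing_outside:
  assumes "interlacing N L" "\<not> (1 \<le> j \<and> j \<le> k \<and> k \<le> N)"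
  shows "L k j = 0"
  using assms unfolding interlacing_def by blast

text \<open>Lets the move at level \<open>N\<close> be computed in the truncated array, where the
  induction hypothesis speaks.\<close>

lemma moved_cong:
  assumes "\<And>i. i \<le> k \<Longrightarrow> L i = L' i"
  shows "moved h L m k = moved h L' m k"
  using assms
proof (induction k)
  case (Suc k)
  have d: "donate L (Suc k) j = donate L' (Suc k) j" for j
    using Suc.prems[of k] Suc.prems[of "Suc k"] unfolding donate_def blocked_def by simp
  have "moved h L m k = moved h L' m k" using Suc by simp
  then show ?case using d Suc.prems[of k] Suc.prems[of "Suc k"] by (auto simp: Let_def)
qed simp

lemma moved_below: "k < m \<Longrightarrow> moved h L m k = 0"
  by (cases k) auto

text \<open>The value 0 of \<open>moved\<close> below level \<open>m\<close> selects the starting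
  branch of \<open>next_moved\<close>, which merges the start and the step rule. The last assumption
  keeps 0 from occurring once a particle has moved.\<close>

lemma moved_Suc:
  assumes "m \<le> Suc k" "1 \<le> h (Suc k)" "m \<le> k \<Longrightarrow> 1 \<le> moved h L m k"
  shows "moved h L m (Suc k) =
    next_moved (h (Suc k)) (L k) (L (Suc k)) (moved h L m k)"
proof (cases "m = Suc k")
  case True
  then show ?thesis using assms(2) moved_below[of k m h L]
    by (simp add: next_moved_def donate_eq_don)
next
  case False
  then show ?thesis using assms by (auto simp: next_moved_def donate_eq_don Let_def)
qed

declare moved.simps(2) [simp del]

text \<open>The second assumption excludes index 0 as a genuine move: there \<open>h_insert\<close>
  would increase an entry, while \<open>inc\<close> would not.\<close>

lemma h_insert_Suc:
  assumes "1 \<le> m" "m \<le> Suc N \<Longrightarrow> 1 \<le> moved h L m (Suc N)"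
  shows "h_insert (Suc N) h m L =
    (h_insert N h m (truncate_array N L))(Suc N := inc (moved h L m (Suc N)) (L (Suc N)))"
proof (intro ext)
  fix k j
  have "moved h (truncate_array N L) m k = moved h L m k" if "k \<le> N"
    using that by (intro moved_cong) auto
  then show "h_insert (Suc N) h m L k j = ((h_insert N h m (truncate_array N L))
      (Suc N := inc (moved h L m (Suc N)) (L (Suc N)))) k j"
    using assms moved_below[of "Suc N" m h L]
    by (cases "k \<le> N"; cases "m \<le> Suc N"; cases "k = Suc N")
      (auto simp: h_insert_def inc_def)
qed

lemma h_insert_level:
  assumes "1 \<le> m" "m \<le> N \<Longrightarrow> 1 \<le> moved h L m N"
  shows "h_insert N h m L N = inc (moved h L m N) (L N)"
  using assms moved_below[of N m h L]
  by (cases "m \<le> N") (auto simp: h_insert_def inc_def fun_eq_iff)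

text \<open>Allowing the dummy letter \<open>N + 1\<close>, which moves nothing (recorded as index 0), lets one
  induction on \<open>N\<close> treat the level where the insertion starts like all others.\<close>

lemma h_insert_forward:
  assumes "\<forall>k\<in>{1..N}. 1 \<le> h k \<and> h k \<le> k" "interlacing N L" "1 \<le> m" "m \<le> Suc N"
  shows "moved h L m N \<le> N \<and> (m \<le> N \<longrightarrow> 1 \<le> moved h L m N) \<and>
    (2 \<le> moved h L m N \<longrightarrow> L N (moved h L m N) < L N (moved h L m N - 1)) \<and>
    interlacing N (h_insert N h m L)"
  using assms
proof (induction N arbitrary: L m)
  case 0
  then have "h_insert 0 h m L = L" by (auto simp: h_insert_def fun_eq_iff)
  then show ?case using 0 by simp
next
  case (Suc N)
  let ?L = "truncate_array N L"
  have il: "interlacing N ?L" "interlaces N (L N) (L (Suc N))"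
    and z: "\<And>j. \<not> (1 \<le> j \<and> j \<le> Suc N) \<Longrightarrow> L (Suc N) j = 0"
    using Suc.prems(2) unfolding interlacing_Suc by auto
  have H: "1 \<le> h (Suc N)" "h (Suc N) \<le> Suc N" using Suc.prems(1) by auto
  show ?case
  proof (cases "m = Suc (Suc N)")
    case True
    then have "h_insert (Suc N) h m L = L" by (auto simp: h_insert_def fun_eq_iff)
    then show ?thesis using True Suc.prems moved_below[of "Suc N" m h L] by simp
  next
    case False
    then have m: "m \<le> Suc N" using Suc.prems by simp
    have eq: "moved h ?L m N = moved h L m N" by (intro moved_cong) auto
    have "\<forall>k\<in>{1..N}. 1 \<le> h k \<and> h k \<le> k" using Suc.prems(1) by auto
    then have IH: "moved h ?L m N \<le> N \<and> (m \<le> N \<longrightarrow> 1 \<le> moved h ?L m N) \<and>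
        (2 \<le> moved h ?L m N \<longrightarrow> ?L N (moved h ?L m N) < ?L N (moved h ?L m N - 1)) \<and>
        interlacing N (h_insert N h m ?L)"
      using il(1) Suc.prems(3) m by (rule Suc.IH)
    have IH: "moved h L m N \<le> N" "m \<le> N \<Longrightarrow> 1 \<le> moved h L m N"
      "2 \<le> moved h L m N \<Longrightarrow> L N (moved h L m N) < L N (moved h L m N - 1)"
      "interlacing N (h_insert N h m ?L)"
      using IH eq by simp_all
    have mv: "moved h L m (Suc N) =
        next_moved (h (Suc N)) (L N) (L (Suc N)) (moved h L m N)"
      using m H IH by (intro moved_Suc) auto
    \<comment> \<open>The strict descent carried through the induction is what the local rule
      assumes about the lower level.\<close>
    note fw = next_moved_forward[OF il(2) H IH(1,3), folded mv]
    have ins: "h_insert (Suc N) h m L =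
        (h_insert N h m ?L)(Suc N := inc (moved h L m (Suc N)) (L (Suc N)))"
      using Suc.prems fw(1) by (intro h_insert_Suc) auto
    have lev: "h_insert N h m ?L N = inc (moved h L m N) (L N)"
      using h_insert_level[of m N h ?L] Suc.prems(3) IH(2) eq by simp
    have "truncate_array N (h_insert (Suc N) h m L) = h_insert N h m ?L"
      unfolding ins using interlacing_outside[OF IH(4)] by (auto simp: fun_eq_iff)
    then have "interlacing (Suc N) (h_insert (Suc N) h m L)"
      unfolding interlacing_Suc using IH(4) fw(1-3) z lev ins by (auto simp: inc_def)
    then show ?thesis using fw by auto
  qed
qed

text \<open>Local inversion at the top gives the only possible lower index \<open>j\<close>, and the
  induction hypothesis inverts the truncated array with \<open>j\<close> in place of
  \<open>r\<close>. For \<open>r = 0\<close> nothing has moved at the top, so the letter is the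
  dummy one. Otherwise the last assumption says that row \<open>r\<close> ends in a removable
  box.\<close>

lemma h_insert_backward:
  assumes "\<forall>k\<in>{1..N}. 1 \<le> h k \<and> h k \<le> k" "interlacing N L'" "r \<le> N"
    "r = 0 \<or> L' N (Suc r) < L' N r"
  shows "\<exists>!(m, L). 1 \<le> m \<and> m \<le> Suc N \<and> interlacing N L \<and> h_insert N h m L = L' \<and>
    moved h L m N = r"
  using assms
proof (induction N arbitrary: L' r)
  case 0
  have "h_insert 0 h m L = L" if "1 \<le> m" for m L using that by (auto simp: h_insert_def fun_eq_iff)
  then show ?case using 0 by (intro ex1I[of _ "(1, L')"]) auto
next
  case (Suc N)
  let ?t = "truncate_array N"
  have il: "interlacing N (?t L')" "interlaces N (L' N) (L' (Suc N))"
    and z: "\<And>j. \<not> (1 \<le> j \<and> j \<le> Suc N) \<Longrightarrow> L' (Suc N) j = 0"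
    using Suc.prems(2) unfolding interlacing_Suc by auto
  have H: "1 \<le> h (Suc N)" "h (Suc N) \<le> Suc N" and hN: "\<forall>k\<in>{1..N}. 1 \<le> h k \<and> h k \<le> k"
    using Suc.prems(1) by auto
  have L0: "L' N 0 = 0" using interlacing_outside[OF il(1), of 0 N] by simp
  note fwd = h_insert_forward[OF Suc.prems(1)]
  show ?case
  proof (cases "r = 0")
    case True
    have id: "h_insert (Suc N) h (Suc (Suc N)) L = L" for L
      by (auto simp: h_insert_def fun_eq_iff)
    show ?thesis
    proof (intro ex1I[of _ "(Suc (Suc N), L')"])
      fix p assume p: "case p of (m, L) \<Rightarrow> 1 \<le> m \<and> m \<le> Suc (Suc N) \<and> interlacing (Suc N) L \<and>
        h_insert (Suc N) h m L = L' \<and> moved h L m (Suc N) = r"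
      obtain m L where [simp]: "p = (m, L)" by fastforce
      \<comment> \<open>Any smaller letter would move a particle of positive index at the top
        level.\<close>
      have "m = Suc (Suc N)" using p True fwd[of L m] by (auto)
      then show "p = (Suc (Suc N), L')" using p id by simp
    qed (use True id Suc.prems moved_below[of "Suc N" "Suc (Suc N)" h L'] in simp)
  next
    case False
    then have r: "1 \<le> r" "r \<le> Suc N" "L' (Suc N) (Suc r) < L' (Suc N) r"
      using Suc.prems by auto
    let ?lam = "dec r (L' (Suc N))"
    \<comment> \<open>\<open>J\<close> collects the local inverses at the two top levels,
      \<open>I\<close> the solutions below them, \<open>G\<close> the solutions sought.\<close>
    define J where "J j \<longleftrightarrow> j \<le> N \<and> (j = 0 \<or> 0 < L' N j) \<and> interlaces N (dec j (L' N)) ?lam \<and>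
      next_moved (h (Suc N)) (dec j (L' N)) ?lam j = r" for j
    define I where "I j m L \<longleftrightarrow> 1 \<le> m \<and> m \<le> Suc N \<and> interlacing N L \<and> h_insert N h m L = ?t L' \<and>
      moved h L m N = j" for j m L
    define G where "G m L \<longleftrightarrow> 1 \<le> m \<and> m \<le> Suc (Suc N) \<and> interlacing (Suc N) L \<and>
      h_insert (Suc N) h m L = L' \<and> moved h L m (Suc N) = r" for m L
    have exJ: "\<exists>!j. J j" unfolding J_def by (rule next_moved_backward[OF il(2) H r L0])
    have exI: "\<exists>!(m, L). I j m L" if "J j" for j
      unfolding I_def
    proof (rule Suc.IH[OF hN il(1)])
      show "j \<le> N" using that by (simp add: J_def)
      \<comment> \<open>Row \<open>j\<close> of level \<open>N\<close> ends in a removable box,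
        since \<open>?lam (Suc j)\<close> lies between the two rows and strictly below the longer
        one.\<close>
      show "j = 0 \<or> ?t L' N (Suc j) < ?t L' N j"
      proof (cases "j = 0")
        case False
        then have "?lam (Suc j) \<le> dec j (L' N) j" "0 < L' N j"
          using that by (auto simp: interlaces_def J_def)
        then have lt: "?lam (Suc j) < L' N j" by (auto simp: dec_def)
        have "L' N (Suc j) \<le> ?lam (Suc j)"
        proof (cases "Suc j \<le> N")
          case True
          then have "dec j (L' N) (Suc j) \<le> ?lam (Suc j)"
            using that unfolding interlaces_def J_def by auto
          then show ?thesis by (simp add: dec_def)
        next
          case False
          then show ?thesis using interlacing_outside[OF il(1), of "Suc j" N] by simp
        qed
        then show ?thesis using lt by simp
      qed simp
    qed
    \<comment> \<open>Moves depend only on the levels up to their own, so undoing the top level and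
      undoing the rest separate; the index \<open>j\<close> is all they share.\<close>
    have G_iff: "G m L \<longleftrightarrow> (\<exists>j. J j \<and> I j m (?t L)) \<and> L (Suc N) = ?lam" for m L
    proof
      assume "G m L"
      note G = this[unfolded G_def]
      then have m: "1 \<le> m" "m \<le> Suc N"
        using r moved_below[of "Suc N" m h L] by (fastforce simp: not_le)+
      have ilL: "interlacing N (?t L)" "interlaces N (L N) (L (Suc N))" "L (Suc N) 0 = 0"
        using G unfolding interlacing_Suc by auto
      have eq: "moved h (?t L) m N = moved h L m N" by (intro moved_cong) auto
      have fwN: "moved h L m N \<le> N" "m \<le> N \<Longrightarrow> 1 \<le> moved h L m N"
        "interlacing N (h_insert N h m (?t L))"
        using h_insert_forward[OF hN ilL(1) m] eq by auto
      have ins: "L' = (h_insert N h m (?t L))(Suc N := inc r (L (Suc N)))"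
        using h_insert_Suc[of m N h L] G r by auto
      have t: "?t L' = h_insert N h m (?t L)"
        unfolding ins using interlacing_outside[OF fwN(3)] by (auto simp: fun_eq_iff)
      have lev: "L' N = inc (moved h L m N) (L N)"
        using h_insert_level[of m N h "?t L"] m fwN(2) eq ins by simp
      have lam: "L (Suc N) = ?lam" unfolding ins using ilL(3) by (simp add: dec_inc)
      have mu: "L N = dec (moved h L m N) (L' N)"
        unfolding lev using interlacing_outside[OF ilL(1), of 0 N] by (simp add: dec_inc)
      have "moved h L m (Suc N) = next_moved (h (Suc N)) (L N) (L (Suc N)) (moved h L m N)"
        using m H fwN by (intro moved_Suc) auto
      moreover have "moved h L m N = 0 \<or> 0 < L' N (moved h L m N)"
        unfolding lev by (simp add: inc_def)
      ultimately have "J (moved h L m N)"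
        unfolding J_def mu[symmetric] lam[symmetric] using G fwN(1) ilL(2) by simp
      moreover have "I (moved h L m N) m (?t L)" unfolding I_def using m G t eq interlacing_Suc by auto
      ultimately show "(\<exists>j. J j \<and> I j m (?t L)) \<and> L (Suc N) = ?lam" using lam by blast
    next
      assume "(\<exists>j. J j \<and> I j m (?t L)) \<and> L (Suc N) = ?lam"
      then obtain j where "J j" "I j m (?t L)" and lam: "L (Suc N) = ?lam" by blast
      note J = this(1)[unfolded J_def] and I = this(2)[unfolded I_def]
      have eq: "moved h L m N = j"
        using I moved_cong[of N "?t L" L h m] by auto
      have fwN: "m \<le> N \<Longrightarrow> 1 \<le> j"
        using h_insert_forward[OF hN, of "?t L" m] I by auto
      have L00: "L N 0 = 0" using interlacing_outside[of N "?t L" 0 N] I by simp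
      have "L' N = inc j (L N)"
        using h_insert_level[of m N h "?t L"] I fwN by (metis fun_upd_other n_not_Suc_n)
      then have mu: "L N = dec j (L' N)" using L00 by (simp add: dec_inc)
      have mv: "moved h L m (Suc N) = r"
        using moved_Suc[of m N h L] I H fwN J eq lam mu by auto
      have lr: "inc r ?lam = L' (Suc N)" using r z[of 0] by (intro inc_dec) auto
      have "h_insert (Suc N) h m L = (?t L')(Suc N := inc r ?lam)"
        using h_insert_Suc[of m N h L] I r mv lam by auto
      then have "h_insert (Suc N) h m L = L'" using lr by (auto simp: fun_eq_iff)
      moreover have "interlacing (Suc N) L"
        unfolding interlacing_Suc using I J mu lam z by (auto simp: dec_def)
      ultimately show "G m L" unfolding G_def using I mv by auto
    qed
    obtain j where J: "J j" using exJ by blast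
    obtain m0 L0 where I: "I j m0 L0" using exI[OF J] by blast
    have uI: "m = m0 \<and> L = L0" if "I j m L" for m L using exI[OF J] I that by blast
    have "\<exists>!(m, L). G m L"
    proof (intro ex1I[of _ "(m0, L0(Suc N := ?lam))"])
      \<comment> \<open>\<open>L0\<close> vanishes at the top level, so truncating its extension by
        \<open>?lam\<close> gives it back.\<close>
      have "L0 (Suc N) = (\<lambda>_. 0)" 
        using interlacing_outside[of N L0 _ "Suc N"] I by (auto simp: I_def)
      then have "?t (L0(Suc N := ?lam)) = L0" by (auto simp: fun_eq_iff)
      then have "G m0 (L0(Suc N := ?lam))" unfolding G_iff using I J by auto
      then show "case (m0, L0(Suc N := ?lam)) of (m, L) \<Rightarrow> G m L" by simp
    next
      fix p assume p: "case p of (m, L) \<Rightarrow> G m L"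
      obtain m L where [simp]: "p = (m, L)" by fastforce
      have "G m L" using p by simp
      then obtain j' where j': "J j'" "I j' m (?t L)" and lam: "L (Suc N) = ?lam"
        unfolding G_iff by blast
      have "j' = j" using exJ j'(1) J by blast
      then have eqs: "m = m0 \<and> ?t L = L0" using j'(2) by (intro uI) simp
      have "L = (?t L)(Suc N := L (Suc N))" by simp
      also have "\<dots> = L0(Suc N := ?lam)" by (simp only: conjunct2[OF eqs] lam)
      finally show "p = (m0, L0(Suc N := ?lam))" using eqs by simp
    qed
    then show ?thesis unfolding G_def .
  qed
qed

section \<open>Interlacing arrays as semistandard tableaux\<close>

definition diagram :: "(nat \<Rightarrow> nat) \<Rightarrow> (nat \<times> nat) set" where
  "diagram f = {(i, c). 1 \<le> i \<and> 1 \<le> c \<and> c \<le> f i}"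

lemma dom_tableau_of_array: "dom (tableau_of_array N L) = diagram (L N)"
  by (auto simp: tableau_of_array_def diagram_def split: if_splits)

lemma diagram_inc:
  assumes "1 \<le> r"
  shows "diagram (inc r f) = insert (r, Suc (f r)) (diagram f)" "(r, Suc (f r)) \<notin> diagram f"
  using assms by (auto simp: diagram_def inc_def split: if_splits)

text \<open>The zeros outside the triangle extend the inequalities to every index \<open>i\<close>
  from 1 on, which spares later range checks.\<close>

lemma interlacing_step:
  assumes "interlacing N L" "Suc k \<le> N" "1 \<le> i"
  shows "L (Suc k) (Suc i) \<le> L k i" "L k i \<le> L (Suc k) i"
proof -
  show "L k i \<le> L (Suc k) i" using interlacing_mono[OF assms(1) _ assms(2)] by simp
  show "L (Suc k) (Suc i) \<le> L k i"
  proof (cases "i \<le> k")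
    case True
    then have "Suc k \<in> {2..N}" "i \<in> {1..<Suc k}" using assms by auto
    then have "L (Suc k) (i + 1) \<le> L (Suc k - 1) i"
      using assms(1) unfolding interlacing_def by blast
    then show ?thesis by simp
  next
    case False
    then show ?thesis using interlacing_outside[OF assms(1), of "Suc i" "Suc k"] by simp
  qed
qed

lemma interlacing_decreasing:
  assumes "interlacing N L" "k \<le> N" "1 \<le> i" "i \<le> j"
  shows "L k j \<le> L k i"
  using assms(4)
proof (induction j rule: dec_induct)
  case (step j)
  have "L k (Suc j) \<le> L k j"
  proof (cases k)
    case 0
    then show ?thesis using interlacing_outside[OF assms(1), of "Suc j" 0] by simp
  next
    case (Suc l)
    then show ?thesis using interlacing_step[OF assms(1), of l j] assms step by simp
  qed
  with step show ?case by simp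
qed simp

lemma young_diagram_diagram:
  assumes "interlacing N L"
  shows "young_diagram (diagram (L N))"
proof -
  have "diagram (L N) \<subseteq> {1..N} \<times> {1..L N 1}"
  proof
    fix p assume "p \<in> diagram (L N)"
    then obtain i c where p: "p = (i, c)" "1 \<le> i" "1 \<le> c" "c \<le> L N i"
      by (auto simp: diagram_def)
    then have "i \<le> N" using interlacing_outside[OF assms, of i N] by (cases "i \<le> N") auto
    then show "p \<in> {1..N} \<times> {1..L N 1}"
      using p interlacing_decreasing[OF assms, of N 1 i] by auto
  qed
  then have "finite (diagram (L N))" by (rule finite_subset) simp
  moreover have "{1..i} \<times> {1..c} \<subseteq> diagram (L N)" if "(i, c) \<in> diagram (L N)" for i c
    using that interlacing_decreasing[OF assms order_refl, of _ i]
    by (fastforce simp: diagram_def intro: order_trans)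
  ultimately show ?thesis by (auto simp: young_diagram_def diagram_def)
qed

text \<open>For a box of the tableau, its entry is at most \<open>k\<close> exactly when the box
  lies in level \<open>k\<close>, so comparing entries becomes comparing levels.\<close>

lemma semistandard_tableau_of_array:
  assumes "interlacing N L"
  shows "semistandard N (tableau_of_array N L)"
proof -
  let ?T = "tableau_of_array N L"
  have level: "c \<le> L k i" if "?T (i, c) = Some a" "a \<le> k" "k \<le> N" for i c a k
    using tableau_of_array_level[OF assms that(3)] that by blast
  have level': "a \<le> k" if "?T (i, c) = Some a" "c \<le> L k i" "k \<le> N" for i c a k
  proof -
    have "(i, c) \<in> {(i, c). 1 \<le> i \<and> 1 \<le> c \<and> c \<le> L k i}"
      using that by (auto simp: tableau_of_array_def split: if_splits)
    then have "(i, c) \<in> {(i, c). \<exists>a. ?T (i, c) = Some a \<and> a \<le> k}"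
      unfolding tableau_of_array_level[OF assms that(3)] .
    then show ?thesis using that(1) by simp
  qed
  have box: "1 \<le> i" "1 \<le> c" "a \<le> N" "1 \<le> a" if "?T (i, c) = Some a" for i c a
  proof -
    show "1 \<le> i" and c: "1 \<le> c"
      using that by (auto simp: tableau_of_array_def split: if_splits)
    show "a \<le> N"
      using that by (intro level'[OF that]) (auto simp: tableau_of_array_def split: if_splits)
    then show "1 \<le> a"
      using level[OF that, of 0] c interlacing_outside[OF assms, of i 0] by (cases a) auto
  qed
  have row: "a \<le> b" if "c < d" "?T (i, c) = Some a" "?T (i, d) = Some b" for i c d a b
    using level[OF that(3) order_refl] level'[OF that(2), of b] box[OF that(3)] that(1) by simp
  have col: "a < b" if ij: "i < j" and a: "?T (i, c) = Some a" and b: "?T (j, c) = Some b" for i j c a b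
  proof -
    obtain b' where bS: "b = Suc b'" using box(4)[OF b] by (cases b) auto
    then have b': "Suc b' \<le> N" using box(3)[OF b] bS by simp
    obtain j' where j: "j = Suc j'" using ij by (cases j) auto
    have i: "1 \<le> i" "i \<le> j'" using box(1)[OF a] ij j by auto
    \<comment> \<open>Interlacing trades one row for one level: a box of row \<open>j' + 1\<close>
      at level \<open>b' + 1\<close> forces the box above it to be present at level
      \<open>b'\<close> already.\<close>
    have "c \<le> L (Suc b') (Suc j')" using level[OF b order_refl] b' bS j by simp
    also have "\<dots> \<le> L b' j'" using interlacing_step[OF assms b'] i by simp
    also have "\<dots> \<le> L b' i" using interlacing_decreasing[OF assms _ i] b' by simp
    finally show ?thesis using level'[OF a, of b'] bS b' by simp
  qed
  show ?thesis
    unfolding semistandard_def dom_tableau_of_array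
    using young_diagram_diagram[OF assms] box row col by (auto simp: ran_def)
qed

text \<open>The boxes with entries at most \<open>k\<close> form level \<open>k\<close>, so the
  tableau determines every level.\<close>

lemma tableau_of_array_inj:
  assumes "interlacing N L" "interlacing N L'" "tableau_of_array N L = tableau_of_array N L'"
  shows "L = L'"
proof (intro ext)
  fix k i
  show "L k i = L' k i"
  proof (cases "1 \<le> i \<and> i \<le> k \<and> k \<le> N")
    case True
    then have "{(i, c). 1 \<le> i \<and> 1 \<le> c \<and> c \<le> L k i} = {(i, c). 1 \<le> i \<and> 1 \<le> c \<and> c \<le> L' k i}"
      using tableau_of_array_level[OF assms(1), of k] tableau_of_array_level[OF assms(2), of k]
        assms(3) by simp
    then have "1 \<le> i \<and> 1 \<le> c \<and> c \<le> L k i \<longleftrightarrow> 1 \<le> i \<and> 1 \<le> c \<and> c \<le> L' k i" for c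
      by (auto simp: set_eq_iff)
    \<comment> \<open>Taking either row length as the column bounds it by the other.\<close>
    from this[of "L k i"] this[of "L' k i"] show ?thesis using True by linarith
  next
    case False
    then show ?thesis using interlacing_outside assms(1,2) by metis
  qed
qed

section \<open>Rules for Young diagrams and tableaux, and the array of a semistandard
  tableau\<close>

lemma young_diagramI:
  assumes "finite D" "\<And>i c. (i, c) \<in> D \<Longrightarrow> 1 \<le> i \<and> 1 \<le> c \<and> {1..i} \<times> {1..c} \<subseteq> D"
  shows "young_diagram D"
  unfolding young_diagram_def
proof (intro conjI assms(1) ballI)
  fix p assume "p \<in> D"
  then show "case p of (i, c) \<Rightarrow> 1 \<le> i \<and> 1 \<le> c \<and> {1..i} \<times> {1..c} \<subseteq> D"
    using assms(2)[of "fst p" "snd p"] by (simp add: split_beta)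
qed

lemma young_diagramD:
  assumes "young_diagram D" "(i, c) \<in> D"
  shows "1 \<le> i \<and> 1 \<le> c \<and> {1..i} \<times> {1..c} \<subseteq> D"
proof -
  have "\<forall>(i, c)\<in>D. 1 \<le> i \<and> 1 \<le> c \<and> {1..i} \<times> {1..c} \<subseteq> D"
    using assms(1) unfolding young_diagram_def by (rule conjunct2)
  from bspec[OF this assms(2)] show ?thesis by simp
qed

lemma semistandardD:
  assumes "semistandard N T"
  shows "T x = Some a \<Longrightarrow> 1 \<le> a \<and> a \<le> N"
    "c < d \<Longrightarrow> T (i, c) = Some a \<Longrightarrow> T (i, d) = Some b \<Longrightarrow> a \<le> b"
    "i < j \<Longrightarrow> T (i, c) = Some a \<Longrightarrow> T (j, c) = Some b \<Longrightarrow> a < b"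
proof -
  have "ran T \<subseteq> {1..N}" using assms unfolding semistandard_def by (elim conjE)
  then show "T x = Some a \<Longrightarrow> 1 \<le> a \<and> a \<le> N" using ranI[of T x a] by auto
  have "\<forall>i c d a b. c < d \<longrightarrow> T (i, c) = Some a \<longrightarrow> T (i, d) = Some b \<longrightarrow> a \<le> b"
    using assms unfolding semistandard_def by (elim conjE)
  then show "c < d \<Longrightarrow> T (i, c) = Some a \<Longrightarrow> T (i, d) = Some b \<Longrightarrow> a \<le> b" by blast
  have "\<forall>i j c a b. i < j \<longrightarrow> T (i, c) = Some a \<longrightarrow> T (j, c) = Some b \<longrightarrow> a < b"
    using assms unfolding semistandard_def by (elim conjE)
  then show "i < j \<Longrightarrow> T (i, c) = Some a \<Longrightarrow> T (j, c) = Some b \<Longrightarrow> a < b" by blast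
qed

lemma standardD:
  assumes "standard T"
  shows "c < d \<Longrightarrow> T (i, c) = Some a \<Longrightarrow> T (i, d) = Some b \<Longrightarrow> a < b"
    "i < j \<Longrightarrow> T (i, c) = Some a \<Longrightarrow> T (j, c) = Some b \<Longrightarrow> a < b"
    "(i, c) \<in> dom T \<Longrightarrow> {1..i} \<times> {1..c} \<subseteq> dom T"
proof -
  have "\<forall>i c d a b. c < d \<longrightarrow> T (i, c) = Some a \<longrightarrow> T (i, d) = Some b \<longrightarrow> a < b"
    using assms unfolding standard_def by (elim conjE)
  then show "c < d \<Longrightarrow> T (i, c) = Some a \<Longrightarrow> T (i, d) = Some b \<Longrightarrow> a < b" by blast
  have "\<forall>i j c a b. i < j \<longrightarrow> T (i, c) = Some a \<longrightarrow> T (j, c) = Some b \<longrightarrow> a < b"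
    using assms unfolding standard_def by (elim conjE)
  then show "i < j \<Longrightarrow> T (i, c) = Some a \<Longrightarrow> T (j, c) = Some b \<Longrightarrow> a < b" by blast
  show "(i, c) \<in> dom T \<Longrightarrow> {1..i} \<times> {1..c} \<subseteq> dom T"
    using assms young_diagramD[of "dom T" i c] by (simp add: standard_def)
qed

lemma standardI:
  assumes "young_diagram (dom T)" "ran T = {1..card (dom T)}" "inj_on T (dom T)"
    and "\<And>i c d a b. c < d \<Longrightarrow> T (i, c) = Some a \<Longrightarrow> T (i, d) = Some b \<Longrightarrow> a < b"
    and "\<And>i j c a b. i < j \<Longrightarrow> T (i, c) = Some a \<Longrightarrow> T (j, c) = Some b \<Longrightarrow> a < b"
  shows "standard T"
  unfolding standard_def by (intro conjI allI impI; rule assms; assumption)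

text \<open>Serves to read a row length off a cardinality.\<close>

lemma down_closed_eq_interval:
  fixes S :: "nat set"
  assumes "finite S" "\<And>c. c \<in> S \<Longrightarrow> {1..c} \<subseteq> S \<and> 1 \<le> c"
  shows "S = {1..card S}"
proof (cases "S = {}")
  case False
  then have "Max S \<in> S" using assms(1) by simp
  then have "S = {1..Max S}" using assms Max_ge by fastforce
  then show ?thesis by (metis card_atLeastAtMost diff_Suc_1)
qed simp

text \<open>\<open>L k i\<close> counts the entries at most \<open>k\<close> in row
  \<open>i\<close>. By column strictness the box above an entry at most \<open>k\<close> holds one
  at most \<open>k - 1\<close>, which gives interlacing, and entries of row \<open>i\<close> are at
  least \<open>i\<close>, which gives the zeros for \<open>i > k\<close>.\<close>

lemma array_of_semistandard:
  assumes "semistandard N T"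
  obtains L where "interlacing N L" "tableau_of_array N L = T"
proof -
  have yd: "finite (dom T)"
      "\<And>i c. (i, c) \<in> dom T \<Longrightarrow> 1 \<le> i \<and> 1 \<le> c \<and> {1..i} \<times> {1..c} \<subseteq> dom T"
    using assms young_diagramD[of "dom T"] by (auto simp: semistandard_def young_diagram_def)
  note rn = semistandardD(1)[OF assms]
  note row = semistandardD(2)[OF assms] and col = semistandardD(3)[OF assms]
  have up: "\<exists>a'. T (i, c) = Some a' \<and> a' < a" if "T (Suc i, c) = Some a" "1 \<le> i" for i c a
  proof -
    have sub: "1 \<le> c" "{1..Suc i} \<times> {1..c} \<subseteq> dom T" using yd(2)[of "Suc i" c] that(1) by blast+
    have "(i, c) \<in> {1..Suc i} \<times> {1..c}" using sub(1) that(2) by simp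
    then have "(i, c) \<in> dom T" using sub(2) by blast
    then show ?thesis using col[of i "Suc i"] that by blast
  qed
  have ge: "i \<le> a" if "T (i, c) = Some a" for i c a
    using that
  proof (induction i arbitrary: a)
    case (Suc i)
    show ?case
    proof (cases "1 \<le> i")
      case True
      then show ?thesis using up[OF Suc.prems] Suc.IH by fastforce
    next
      case False
      then show ?thesis using rn[OF Suc.prems] by simp
    qed
  qed simp
  define S where "S k i = {c. \<exists>a. T (i, c) = Some a \<and> a \<le> k}" for k i
  \<comment> \<open>The cutoff matters: beyond \<open>N\<close> the set \<open>S k i\<close> is the
    full row, while the array has to vanish.\<close>
  define L where "L k i = (if k \<le> N then card (S k i) else 0)" for k i
  have fin: "finite (S k i)" for k i
  proof (rule finite_subset)
    show "S k i \<subseteq> snd ` dom T" by (force simp: S_def)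
  qed (use yd(1) in simp)
  have S: "S k i = {1..card (S k i)}" for k i
  proof (rule down_closed_eq_interval[OF fin])
    fix c assume "c \<in> S k i"
    then obtain a where a: "T (i, c) = Some a" "a \<le> k" by (auto simp: S_def)
    then have d: "1 \<le> i" "1 \<le> c" "{1..i} \<times> {1..c} \<subseteq> dom T" using yd(2) by blast+
    have "c' \<in> S k i" if "c' \<in> {1..c}" for c'
    proof -
      have "(i, c') \<in> {1..i} \<times> {1..c}" using d(1) that by simp
      then obtain a' where a': "T (i, c') = Some a'" using d(3) by blast
      then have "a' \<le> a" using row[of c' c i a' a] a that by (cases "c' = c") auto
      then show ?thesis using a a' by (auto simp: S_def)
    qed
    then show "{1..c} \<subseteq> S k i \<and> 1 \<le> c" using d by blast
  qed
  have LS: "1 \<le> c \<and> c \<le> L k i \<longleftrightarrow> c \<in> S k i" if "k \<le> N" for k i c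
    using that S[of k i] by (auto simp: L_def set_eq_iff)
  have LI: "L k i \<le> L k' i'" if "S k i \<subseteq> S k' i'" "k' \<le> N" for k k' i i'
    using that card_mono[OF fin that(1)] by (simp add: L_def)
  have il: "interlacing N L"
    unfolding interlacing_def
  proof (intro conjI ballI allI impI)
    fix k j assume k: "k \<in> {2..N}" and j: "j \<in> {1..<k}"
    have "S k (j + 1) \<subseteq> S (k - 1) j" using up j by (fastforce simp: S_def)
    then show "L k (j + 1) \<le> L (k - 1) j" using k by (intro LI) auto
    have "S (k - 1) j \<subseteq> S k j" by (fastforce simp: S_def)
    then show "L (k - 1) j \<le> L k j" using k by (intro LI) auto
  next
    fix k j assume "\<not> (1 \<le> j \<and> j \<le> k \<and> k \<le> N)"
    \<comment> \<open>Row 0 has no boxes, and for \<open>j > k\<close> every entry of row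
      \<open>j\<close> exceeds \<open>k\<close> by \<open>ge\<close>.\<close>
    then have "S k j = {} \<or> N < k" using ge yd(2) by (fastforce simp: S_def)
    then show "L k j = 0" by (auto simp: L_def)
  qed
  have "tableau_of_array N L (i, c) = T (i, c)" for i c
  proof (cases "T (i, c)")
    case None
    then have "\<not> (1 \<le> c \<and> c \<le> L N i)" unfolding LS[OF order_refl] by (simp add: S_def)
    then show ?thesis using None by (simp add: tableau_of_array_def)
  next
    case (Some a)
    then have box: "1 \<le> i" "1 \<le> c" "a \<le> N" using yd(2)[of i c] rn by auto
    then have "c \<le> L N i" using LS[of N c i] Some by (auto simp: S_def)
    moreover have "(LEAST k. c \<le> L k i) = a"
    proof (rule Least_equality)
      show "c \<le> L a i" using LS[of a c i] Some box by (auto simp: S_def)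
      show "a \<le> k" if "c \<le> L k i" for k
        using LS[of k c i] Some box that by (cases "k \<le> N") (auto simp: S_def)
    qed
    ultimately show ?thesis using Some box by (simp add: tableau_of_array_def)
  qed
  then show ?thesis using il by (intro that[of L]) (auto simp: fun_eq_iff)
qed

section \<open>Adding and removing the largest entry of a standard tableau\<close>

text \<open>No box of \<open>T\<close> lies weakly to the south-east of \<open>b\<close>, as its
  rectangle would contain \<open>b\<close>. So \<open>b\<close> ends its row and column, where the
  largest entry is allowed.\<close>

lemma standard_extend:
  assumes T: "standard T" and b: "b \<notin> dom T" "young_diagram (insert b (dom T))"
  shows "standard (T(b \<mapsto> Suc (card (dom T))))" (is "standard ?T")
proof -
  let ?n = "card (dom T)"
  have fin: "finite (dom T)" using T by (simp add: standard_def young_diagram_def)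
  have le: "a \<le> ?n" if "T x = Some a" for x a
    using T that unfolding standard_def by (metis atLeastAtMost_iff ranI)
  have inj: "inj_on T (dom T)" using T by (simp add: standard_def)
  note row = standardD(1)[OF T] and col = standardD(2)[OF T] and rect = standardD(3)[OF T]
  have pos: "1 \<le> fst b" "1 \<le> snd b" using b(2) by (auto simp: young_diagram_def)
  have notin: "(i, c) \<notin> dom T" if "fst b \<le> i" "snd b \<le> c" for i c
  proof
    assume "(i, c) \<in> dom T"
    then have "{1..i} \<times> {1..c} \<subseteq> dom T" by (rule rect)
    moreover have "b \<in> {1..i} \<times> {1..c}" using that pos by (cases b) auto
    ultimately show False using b by blast
  qed
  have "ran ?T = insert (Suc ?n) {1..?n}"
    using b T by (auto simp: standard_def domIff)
  then have rn: "ran ?T = {1..card (dom ?T)}" using b fin by auto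
  have inj': "inj_on ?T (dom ?T)"
  proof (rule inj_onI)
    fix x y assume xy: "x \<in> dom ?T" "y \<in> dom ?T" "?T x = ?T y"
    have ne: "T z \<noteq> Some (Suc ?n)" for z using le[of z "Suc ?n"] by auto
    show "x = y"
    proof (cases "x = b \<or> y = b")
      case True
      then show ?thesis using xy(3) ne[of x] ne[of y] by (auto split: if_splits)
    next
      case False
      then have "x \<in> dom T" "y \<in> dom T" "T x = T y" using xy by auto
      then show ?thesis using inj by (simp add: inj_on_def)
    qed
  qed
  have row': "a < a'" if "c < d" "?T (i, c) = Some a" "?T (i, d) = Some a'" for i c d a a'
  proof (cases "(i, c) = b")
    case True
    then show ?thesis using notin[of i d] that by (auto simp: domIff split: if_splits)
  next
    case False
    then show ?thesis using le[of "(i, c)" a] row that by (auto split: if_splits)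
  qed
  have col': "a < a'" if "i < j" "?T (i, c) = Some a" "?T (j, c) = Some a'" for i j c a a'
  proof (cases "(i, c) = b")
    case True
    then show ?thesis using notin[of j c] that by (auto simp: domIff split: if_splits)
  next
    case False
    then show ?thesis using le[of "(i, c)" a] col that by (auto split: if_splits)
  qed
  show ?thesis
  proof (rule standardI[OF _ rn inj'])
    show "young_diagram (dom ?T)" using b(2) by simp
  qed (fact row' col')+
qed

text \<open>A right or lower neighbour would hold a larger entry, so the box of the maximum is a
  corner and can be removed.\<close>

lemma standard_remove_max:
  assumes T: "standard T" and b: "T (r, s) = Some (card (dom T))"
  shows "standard (T((r, s) := None))" (is "standard ?T")
    "(Suc r, s) \<notin> dom T" "(r, Suc s) \<notin> dom T"
proof -
  let ?n = "card (dom T)"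
  have fin: "finite (dom T)" and pos: "\<And>i c. (i, c) \<in> dom T \<Longrightarrow> 1 \<le> i \<and> 1 \<le> c"
    using T by (auto simp: standard_def young_diagram_def)
  have ranT: "ran T = {1..?n}" using T by (simp add: standard_def)
  have le: "a \<le> ?n" if "T x = Some a" for x a
    using ranT that by (metis atLeastAtMost_iff ranI)
  have inj: "inj_on T (dom T)" using T by (simp add: standard_def)
  note row = standardD(1)[OF T] and col = standardD(2)[OF T] and rect = standardD(3)[OF T]
  show "(Suc r, s) \<notin> dom T"
  proof
    assume "(Suc r, s) \<in> dom T"
    then obtain a where "T (Suc r, s) = Some a" by blast
    then show False using col[of r "Suc r" s] b le[of "(Suc r, s)" a] by fastforce
  qed
  show "(r, Suc s) \<notin> dom T"
  proof
    assume "(r, Suc s) \<in> dom T"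
    then obtain a where "T (r, Suc s) = Some a" by blast
    then show False using row[of s "Suc s" r] b le[of "(r, Suc s)" a] by fastforce
  qed
  have yd: "young_diagram (dom ?T)"
  proof -
    have "{1..i} \<times> {1..c} \<subseteq> dom T - {(r, s)}" if ic: "(i, c) \<in> dom T" "(i, c) \<noteq> (r, s)" for i c
    proof -
      have sub: "{1..i} \<times> {1..c} \<subseteq> dom T" using ic(1) by (rule rect)
      \<comment> \<open>Otherwise entries would increase weakly from \<open>?n\<close> along row
        \<open>r\<close> to \<open>(r, c)\<close> and down column \<open>c\<close> to
        \<open>(i, c)\<close>, whose entry differs from \<open>?n\<close> and would exceed
        it.\<close>
      have "(r, s) \<notin> {1..i} \<times> {1..c}"
      proof
        assume rs: "(r, s) \<in> {1..i} \<times> {1..c}"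
        then have "(r, c) \<in> {1..i} \<times> {1..c}" using pos[OF ic(1)] by simp
        then have "(r, c) \<in> dom T" using sub by blast
        then obtain a a' where a: "T (r, c) = Some a" "T (i, c) = Some a'" using ic by blast
        have "?n \<le> a" using row[of s c r ?n a] b a rs by (cases "s = c") auto
        moreover have "a \<le> a'" using col[of r i c a a'] a rs by (cases "r = i") auto
        moreover have "?n \<noteq> a'" using inj ic b a(2) unfolding inj_on_def by (metis domI)
        ultimately show False using le[OF a(2)] by simp
      qed
      then show ?thesis using sub by blast
    qed
    note sub = this
    have D: "dom ?T = dom T - {(r, s)}" by simp
    show ?thesis
      unfolding D using fin pos sub by (intro young_diagramI) blast+
  qed
  have card: "card (dom ?T) = ?n - 1" using b fin by (simp add: domI)
  have "ran ?T = {1..?n} - {?n}"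
  proof
    show "ran ?T \<subseteq> {1..?n} - {?n}"
    proof
      fix a assume "a \<in> ran ?T"
      then obtain x where "?T x = Some a" unfolding ran_def by blast
      then have x: "x \<noteq> (r, s)" "T x = Some a" by (auto split: if_splits)
      have "a \<noteq> ?n" using inj x b unfolding inj_on_def by (metis domI)
      then show "a \<in> {1..?n} - {?n}" using ranI[of T x a, OF x(2)] unfolding ranT by simp
    qed
    show "{1..?n} - {?n} \<subseteq> ran ?T"
    proof
      fix a assume a: "a \<in> {1..?n} - {?n}"
      then have "a \<in> ran T" unfolding ranT by simp
      then obtain x where x: "T x = Some a" unfolding ran_def by blast
      then have "x \<noteq> (r, s)" using a b by auto
      then show "a \<in> ran ?T" using x by (intro ranI[of _ x]) simp
    qed
  qed
  also have "\<dots> = {1..?n - 1}" by auto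
  finally have "ran ?T = {1..card (dom ?T)}" unfolding card .
  moreover have "inj_on ?T (dom ?T)"
  proof (rule inj_onI)
    fix x y assume "x \<in> dom ?T" "y \<in> dom ?T" "?T x = ?T y"
    then show "x = y" by (intro inj_onD[OF inj]) auto
  qed
  ultimately show "standard ?T"
  proof (rule standardI[OF yd])
    show "a < b" if "c < d" "?T (i, c) = Some a" "?T (i, d) = Some b" for i c d a b
      using row that by (simp split: if_splits)
    show "a < b" if "i < j" "?T (i, c) = Some a" "?T (j, c) = Some b" for i j c a b
      using col that by (simp split: if_splits)
  qed
qed

section \<open>Recording tableaux and the recovery of the word\<close>

locale h_insertion =
  fixes N :: nat and h :: "nat \<Rightarrow> nat"
  assumes h: "\<forall>k\<in>{1..N}. 1 \<le> h k \<and> h k \<le> k"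
begin

abbreviation arr :: "nat list \<Rightarrow> array" where
  "arr w \<equiv> fold (h_insert N h) w (\<lambda>_ _. 0)"

text \<open>The index that moves at level \<open>N\<close> is the row in which the shape
  grows.\<close>

abbreviation new_box :: "nat \<Rightarrow> array \<Rightarrow> nat \<times> nat" where
  "new_box m L \<equiv> (moved h L m N, Suc (L N (moved h L m N)))"

lemma h_insert_box:
  assumes "interlacing N L" "m \<in> {1..N}"
  shows "1 \<le> moved h L m N" "interlacing N (h_insert N h m L)"
    "h_insert N h m L N = inc (moved h L m N) (L N)"
    "diagram (h_insert N h m L N) = insert (new_box m L) (diagram (L N))"
    "new_box m L \<notin> diagram (L N)"
proof -
  show r: "1 \<le> moved h L m N" and "interlacing N (h_insert N h m L)"
    using h_insert_forward[OF h assms(1), of m] assms(2) by auto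
  show e: "h_insert N h m L N = inc (moved h L m N) (L N)"
    using r assms(2) by (intro h_insert_level) auto
  show "diagram (h_insert N h m L N) = insert (new_box m L) (diagram (L N))"
    "new_box m L \<notin> diagram (L N)"
    unfolding e using diagram_inc[OF r] by auto
qed

lemma interlacing_arr:
  assumes "set w \<subseteq> {1..N}"
  shows "interlacing N (arr w)"
  using assms
proof (induction w rule: rev_induct)
  case (snoc m w)
  then show ?case using h_insert_box(2) by simp
qed (simp add: interlacing_def)

lemma dom_P_tableau: "dom (P_tableau N h w) = diagram (arr w N)"
  by (simp add: P_tableau_def dom_tableau_of_array)

lemma dom_Q_tableau: "dom (Q_tableau N h w) = diagram (arr w N)"
  by (auto simp: Q_tableau_def dom_P_tableau split: if_splits)

lemma diagram_take_subset:
  assumes "set w \<subseteq> {1..N}"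
  shows "diagram (arr (take t w) N) \<subseteq> diagram (arr w N)"
  using assms
proof (induction w rule: rev_induct)
  case (snoc m w)
  then have "diagram (arr w N) \<subseteq> diagram (arr (w @ [m]) N)"
    using h_insert_box(4)[OF interlacing_arr, of w m] by auto
  then show ?case using snoc by (cases "t \<le> length w") auto
qed simp

text \<open>Turns the description of entries by insertion times into a recursion along the word:
  times up to \<open>length w\<close> are unaffected by the last letter, and the time after them
  adds just the new box.\<close>

lemma Q_tableau_snoc:
  assumes "set w \<subseteq> {1..N}" "m \<in> {1..N}"
  shows "Q_tableau N h (w @ [m]) = (Q_tableau N h w)(new_box m (arr w) \<mapsto> Suc (length w))"
proof
  fix b
  let ?n = "length w" and ?b = "new_box m (arr w)" and ?D = "\<lambda>w. diagram (arr w N)"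
  note ins = h_insert_box(4,5)[OF interlacing_arr[OF assms(1)] assms(2)]
  have D: "?D (w @ [m]) = insert ?b (?D w)" "?b \<notin> ?D w" using ins by simp_all
  have added: "added_at N h (w @ [m]) t = added_at N h w t" if "t \<le> ?n" for t
    using that by (simp add: added_at_def)
  have new: "added_at N h (w @ [m]) (Suc ?n) = {?b}"
    using D by (auto simp: added_at_def dom_P_tableau)
  have old: "added_at N h w t \<subseteq> ?D w" for t
    using diagram_take_subset[OF assms(1), of t] by (auto simp: added_at_def dom_P_tableau)
  show "Q_tableau N h (w @ [m]) b = ((Q_tableau N h w)(?b \<mapsto> Suc ?n)) b"
  proof (cases "b = ?b")
    case True
    have "(THE t. t \<in> {1..length (w @ [m])} \<and> b \<in> added_at N h (w @ [m]) t) = Suc ?n"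
    proof (rule the_equality)
      show "t = Suc ?n" if "t \<in> {1..length (w @ [m])} \<and> b \<in> added_at N h (w @ [m]) t" for t
      proof (rule ccontr)
        assume "t \<noteq> Suc ?n"
        then have "b \<in> ?D w" using added[of t] old[of t] that by auto
        then show False using D(2) True by simp
      qed
    qed (use new True in simp)
    then show ?thesis using True D by (simp add: Q_tableau_def dom_P_tableau)
  next
    case False
    \<comment> \<open>A box other than the new one has the same candidate times in both words, so
      the two \<open>THE\<close> terms agree.\<close>
    have "(t \<in> {1..length (w @ [m])} \<and> b \<in> added_at N h (w @ [m]) t) \<longleftrightarrow>
        (t \<in> {1..?n} \<and> b \<in> added_at N h w t)" for t
    proof (cases "t = Suc ?n")
      case True
      then show ?thesis using new \<open>b \<noteq> ?b\<close> by simp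
    next
      case False
      then have "t \<in> {1..length (w @ [m])} \<longleftrightarrow> t \<in> {1..?n}" by auto
      then show ?thesis using added[of t] by (cases "t \<in> {1..?n}") auto
    qed
    then have the: "(THE t. t \<in> {1..length (w @ [m])} \<and> b \<in> added_at N h (w @ [m]) t) =
        (THE t. t \<in> {1..?n} \<and> b \<in> added_at N h w t)"
      by (simp only:)
    have "b \<in> dom (P_tableau N h (w @ [m])) \<longleftrightarrow> b \<in> dom (P_tableau N h w)"
      unfolding dom_P_tableau D(1) using False by blast
    then show ?thesis
      unfolding Q_tableau_def the fun_upd_other[OF False] by (simp only:)
  qed
qed

lemma standard_Q_tableau:
  assumes "set w \<subseteq> {1..N}"
  shows "standard (Q_tableau N h w) \<and> card (dom (Q_tableau N h w)) = length w"
  using assms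
proof (induction w rule: rev_induct)
  case Nil
  have "dom (Q_tableau N h []) = {}" unfolding dom_Q_tableau by (auto simp: diagram_def)
  then have "Q_tableau N h [] = Map.empty" by simp
  then show ?case by (simp add: standard_def young_diagram_def)
next
  case (snoc m w)
  then have w: "set w \<subseteq> {1..N}" "m \<in> {1..N}" by auto
  note IH = snoc.IH[OF w(1)]
  note ins = h_insert_box[OF interlacing_arr[OF w(1)] w(2)]
  let ?Q = "Q_tableau N h w" and ?b = "new_box m (arr w)"
  have b: "?b \<notin> dom ?Q" using ins(5) unfolding dom_Q_tableau .
  have "young_diagram (insert ?b (dom ?Q))"
    using young_diagram_diagram[OF ins(2)] unfolding dom_Q_tableau ins(4) .
  then have "standard (?Q(?b \<mapsto> Suc (card (dom ?Q))))" using IH b by (intro standard_extend) auto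
  moreover have "finite (dom ?Q)" using IH by (simp add: standard_def young_diagram_def)
  then have "card (dom (?Q(?b \<mapsto> Suc (length w)))) = Suc (length w)" using b IH by simp
  ultimately show ?case unfolding Q_tableau_snoc[OF w] using IH by (simp del: fun_upd_apply)
qed

text \<open>Stated for arrays, on which insertion acts; existence yields surjectivity and uniqueness
  injectivity. The box of the largest entry of \<open>Q\<close> was added last: its row feeds
  \<open>h_insert_backward\<close>, which returns the last letter and the earlier array, and
  deleting it from \<open>Q\<close> leaves the recording tableau of the shorter word.\<close>

lemma unique_word:
  assumes "interlacing N L" "standard Q" "dom Q = diagram (L N)" "card (dom Q) = n"
  shows "\<exists>!w. length w = n \<and> set w \<subseteq> {1..N} \<and> arr w = L \<and> Q_tableau N h w = Q"
  using assms
proof (induction n arbitrary: L Q)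
  case 0
  have "finite (dom Q)" using 0 by (simp add: standard_def young_diagram_def)
  then have D: "dom Q = {}" using 0 by simp
  \<comment> \<open>Rows grow with the level, so an empty shape at level \<open>N\<close> makes the
    whole array zero.\<close>
  have "L k i = 0" for k i
  proof (cases "1 \<le> i \<and> i \<le> k \<and> k \<le> N")
    case True
    then have "(i, L k i) \<notin> diagram (L N)" using D 0 by simp
    then show ?thesis using True interlacing_mono[OF 0(1), of k N i] by (auto simp: diagram_def)
  next
    case False
    then show ?thesis using interlacing_outside 0(1) by blast
  qed
  then have "L = (\<lambda>_ _. 0)" by auto
  moreover have "dom (Q_tableau N h []) = {}" unfolding dom_Q_tableau by (auto simp: diagram_def)
  then have "Q_tableau N h [] = Q" using D by simp
  ultimately show ?case by (intro ex1I[of _ "[]"]) auto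
next
  case (Suc n)
  have inj: "inj_on Q (dom Q)" and fin: "finite (dom Q)"
    using Suc.prems by (auto simp: standard_def young_diagram_def)
  have "Suc n \<in> ran Q" using Suc.prems by (simp add: standard_def)
  then obtain r s where b: "Q (r, s) = Some (Suc n)" by (auto simp: ran_def)
  have bmax: "Q (r, s) = Some (card (dom Q))" using b Suc.prems(4) by simp
  note rem = standard_remove_max[OF Suc.prems(2) bmax]
  have "(r, s) \<in> diagram (L N)" using b Suc.prems(3) by auto
  \<comment> \<open>The missing right and lower neighbours say that \<open>s\<close> is the full
    length of row \<open>r\<close> and that the next row is shorter.\<close>
  then have rs: "1 \<le> r" "s = L N r" "L N (Suc r) < L N r" "1 \<le> s"
    using rem(2,3) unfolding Suc.prems(3) by (auto simp: diagram_def)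
  then have rN: "r \<le> N"
    using interlacing_outside[OF Suc.prems(1), of r N] by (cases "r \<le> N") auto
  define G where "G m L0 \<longleftrightarrow> 1 \<le> m \<and> m \<le> Suc N \<and> interlacing N L0 \<and>
    h_insert N h m L0 = L \<and> moved h L0 m N = r" for m L0
  have "\<exists>!(m, L0). G m L0"
    unfolding G_def using rs by (intro h_insert_backward[OF h Suc.prems(1) rN]) auto
  then obtain m L0 where G: "G m L0"
    and uniq: "\<And>m' L'. G m' L' \<Longrightarrow> m' = m \<and> L' = L0" by blast
  have m: "1 \<le> m" "m \<le> Suc N" "interlacing N L0" "h_insert N h m L0 = L" "moved h L0 m N = r"
    using G by (simp_all add: G_def)
  \<comment> \<open>As \<open>r\<close> is positive, \<open>m\<close> is not the dummy
    letter.\<close>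
  have mN: "m \<in> {1..N}" using m rs(1) moved_below[of N m h L0] by (cases "m \<le> N") auto
  note ins = h_insert_box[OF m(3) mN, unfolded m(4,5)]
  have s: "s = Suc (L0 N r)" using ins(3) rs by (simp add: inc_def)
  let ?Q = "Q((r, s) := None)"
  have "dom ?Q = diagram (L0 N)" using ins(4,5) Suc.prems(3) s by auto
  moreover have "card (dom ?Q) = n" using b fin Suc.prems(4) by (simp add: domI)
  ultimately have "\<exists>!w. length w = n \<and> set w \<subseteq> {1..N} \<and> arr w = L0 \<and> Q_tableau N h w = ?Q"
    by (rule Suc.IH[OF m(3) rem(1)])
  then obtain w where w: "length w = n" "set w \<subseteq> {1..N}" "arr w = L0" "Q_tableau N h w = ?Q"
    and w_uniq: "\<And>w'. length w' = n \<Longrightarrow> set w' \<subseteq> {1..N} \<Longrightarrow> arr w' = L0 \<Longrightarrow>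
      Q_tableau N h w' = ?Q \<Longrightarrow> w' = w"
    by (elim ex1E) blast
  show ?case
  proof (rule ex1I[of _ "w @ [m]"])
    have "Q_tableau N h (w @ [m]) = Q"
      unfolding Q_tableau_snoc[OF w(2) mN] using w b s m(5) by auto
    then show "length (w @ [m]) = Suc n \<and> set (w @ [m]) \<subseteq> {1..N} \<and> arr (w @ [m]) = L \<and>
        Q_tableau N h (w @ [m]) = Q"
      using w mN m by auto
  next
    fix v assume v: "length v = Suc n \<and> set v \<subseteq> {1..N} \<and> arr v = L \<and> Q_tableau N h v = Q"
    then obtain w' m' where [simp]: "v = w' @ [m']" by (metis length_Suc_conv_rev)
    have w': "length w' = n" "set w' \<subseteq> {1..N}" "m' \<in> {1..N}" "h_insert N h m' (arr w') = L"
      using v by auto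
    have il': "interlacing N (arr w')" using w'(2) by (rule interlacing_arr)
    let ?b = "new_box m' (arr w')"
    have Q: "Q = (Q_tableau N h w')(?b \<mapsto> Suc n)" using v Q_tableau_snoc[OF w'(2,3)] w'(1) by simp
    then have "Q ?b = Some (Suc n)" by simp
    \<comment> \<open>The value \<open>Suc n\<close> occurs only once in \<open>Q\<close>, so a
      competing word adds its last box in the same row, and \<open>uniq\<close> applies to its last
      step.\<close>
    then have bb: "?b = (r, s)" using inj b unfolding inj_on_def by (metis domI)
    then have "m' = m \<and> arr w' = L0" using w' il' by (intro uniq) (simp add: G_def)
    moreover have "Q_tableau N h w' (r, s) = None"
      using h_insert_box(5)[OF il' w'(3)] bb dom_Q_tableau[of w'] by (metis domIff)
    then have "Q_tableau N h w' = ?Q" using Q bb by (auto simp: fun_eq_iff)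
    ultimately show "v = w @ [m]" using w_uniq w' by simp
  qed
qed

end

theorem theorem7p7:
  fixes N n :: nat and h :: "nat \<Rightarrow> nat"
  assumes "N \<ge> 1"
    and "\<forall>k \<in> {1..N}. 1 \<le> h k \<and> h k \<le> k"
  shows "bij_betw (\<lambda>w. (P_tableau N h w, Q_tableau N h w))
           {w :: nat list. length w = n \<and> set w \<subseteq> {1..N}}
           {(P, Q). semistandard N P \<and> standard Q \<and> dom P = dom Q \<and> card (dom P) = n}"
    (is "bij_betw ?f ?A ?B")
proof -
  interpret h_insertion N h using assms(2) by unfold_locales
  have into: "?f w \<in> ?B" if "w \<in> ?A" for w
  proof -
    have "semistandard N (P_tableau N h w)"
      unfolding P_tableau_def using that
      by (intro semistandard_tableau_of_array interlacing_arr) auto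
    moreover have "dom (P_tableau N h w) = dom (Q_tableau N h w)"
      by (simp only: dom_P_tableau dom_Q_tableau)
    ultimately show ?thesis using standard_Q_tableau[of w] that by auto
  qed
  have inj: "w = w'" if "w \<in> ?A" "w' \<in> ?A" "?f w = ?f w'" for w w'
  proof -
    have w: "length w = n" "set w \<subseteq> {1..N}" "length w' = n" "set w' \<subseteq> {1..N}"
      and Q: "Q_tableau N h w = Q_tableau N h w'" using that by auto
    have "arr w = arr w'"
      using that w by (intro tableau_of_array_inj[OF interlacing_arr interlacing_arr])
        (auto simp: P_tableau_def)
    \<comment> \<open>Array and recording tableau single out \<open>w\<close> among the words of
      length \<open>n\<close>, and \<open>w'\<close> shares both.\<close>
    moreover have "\<exists>!v. length v = n \<and> set v \<subseteq> {1..N} \<and> arr v = arr w \<and>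
        Q_tableau N h v = Q_tableau N h w"
      using standard_Q_tableau[OF w(2)] w by (intro unique_word interlacing_arr dom_Q_tableau) auto
    ultimately show ?thesis using w Q by metis
  qed
  have surj: "\<exists>w\<in>?A. ?f w = (P, Q)" if "(P, Q) \<in> ?B" for P Q
  proof -
    have PQ: "semistandard N P" "standard Q" "dom P = dom Q" "card (dom P) = n" using that by auto
    obtain L where L: "interlacing N L" "tableau_of_array N L = P"
      using array_of_semistandard[OF PQ(1)] .
    \<comment> \<open>The equality of shapes ties \<open>Q\<close> to the top level of the array of
      \<open>P\<close>, as \<open>unique_word\<close> requires.\<close>
    have "dom Q = diagram (L N)" using PQ(3) L(2) dom_tableau_of_array by metis
    then obtain w where "length w = n" "set w \<subseteq> {1..N}" "arr w = L" "Q_tableau N h w = Q"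
      using unique_word[OF L(1) PQ(2), of n] PQ(3,4) by auto
    then show ?thesis using L(2) by (intro bexI[of _ w]) (auto simp: P_tableau_def)
  qed
  have "inj_on ?f ?A" using inj by (intro inj_onI) blast
  moreover have "?f ` ?A = ?B"
  proof
    show "?f ` ?A \<subseteq> ?B" by (rule image_subsetI) (rule into)
    show "?B \<subseteq> ?f ` ?A"
    proof
      fix p assume p: "p \<in> ?B"
      obtain P Q where PQ: "p = (P, Q)" by (rule prod.exhaust)
      obtain w where "w \<in> ?A" "?f w = (P, Q)" using surj[OF p[unfolded PQ]] by (elim bexE)
      then show "p \<in> ?f ` ?A" unfolding PQ by (intro image_eqI[of _ ?f w]) simp_all
    qed
  qed
  ultimately show ?thesis unfolding bij_betw_def by (rule conjI)
qed

end
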